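(* (Relationship between prices with observable prices.) Let $s\in(0,\tfrac18)$, $a=1-\sqrt{2s}\in(\tfrac12,1)$, $\bar r_p(a)=(1-a)^2$, and let $(p_1^*,p_2^* )$ be the equilibrium prices of the prominent firm (Firm 1) and the non-prominent firm (Firm 2) when the return cost is $r$. 1. If the return cost is relatively low, i.e. $0\le r<\bar r_p(a)$, the prominent firm offers the higher price: $p_1^*>p_2^*$. 2. If the return cost is relatively high, i.e. $\bar r_p(a)\le r\le 1-a$, the prominent firm offers the lower price: $p_1^*<p_2^*$. In this case the search order (Firm 1's product first, then Firm 2's) can be achieved solely by consumer rationality, without the need for platform-imposed sorting.
   Context: Two firms sell one product each at zero marginal cost. Consumers (unit mass) have match values $u_1,u_2$, i.i.d. uniform on $[0,1]$. Firm 1 is prominent (searched and bought first, at no search cost); searching and buying product 2 costs $s$; returned units are fully refunded and cost the firm $r$ each. Both prices are observable before searching, so a consumer buys product 2 iff $u_1<a+p_1-p_2$. With $$d_1^n=1-a+p_2-p_1,\quad k_1=\tfrac12(a^2-p_2^2),\quad d_2^r=(a-p_2+p_1)(1-a),\quad k_2=\tfrac{a^2-p_2^2}{2}+(p_1-p_2)(a-p_2),$$ the profits are $$\pi_1(p_1,p_2)=(p_1+r)(d_1^n+k_1)-r,\qquad \pi_2(p_1,p_2)=(p_2+r)(d_2^r+k_2)-r(1-d_1^n).$$ An equilibrium is a pair $(p_1^*,p_2^* )$ such that $p_1^*$ maximizes $\pi_1(\cdot,p_2^* )$ over $p_1\ge0$ and $p_2^*$ maximizes $\pi_2(p_1^*,\cdot)$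 over $p_2\in[0,a]$. For $r\in[0,1-a]$ the equilibrium exists and is unique. On the search order: since consumers hold identical prior beliefs about the match values of the two products, rational consumers willingly inspect the prominent product first when its price is lower; otherwise the platform would have to enforce the displayed order ("platform-imposed sorting").
   Formalization: At r = (1-a)^2 the claimed strict inequality is false, since the equilibrium has p1* = p2* = sqrt(1+2a-a^2)-1; there the formal statement asserts p1* = p2* and that searching Firm 1 first is optimal, and p1* < p2* is claimed for (1-a)^2 < r <= 1-a. *)

theory Defs
  imports "HOL-Probability.Probability"
begin

section \<open>Firms\<close>

text \<open>
  Prices are \<open>p1\<close> (prominent firm) and \<open>p2\<close>; \<open>a\<close> is the reservation match value and \<open>r\<close> the
  return cost. Demand splits into consumers who never visit Firm 2 (\<open>d1n\<close>), consumers who return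
  product 2 and keep product 1 (\<open>k1\<close>), and consumers who return product 1 and keep product 2
  (\<open>d2r + k2\<close>). As in the model, these closed forms are used at all prices.
\<close>

definition d1n :: "real \<Rightarrow> real \<Rightarrow> real \<Rightarrow> real" where
  "d1n a p1 p2 = 1 - a + p2 - p1"

definition k1 :: "real \<Rightarrow> real \<Rightarrow> real \<Rightarrow> real" where
  "k1 a p1 p2 = (a\<^sup>2 - p2\<^sup>2) / 2"

definition d2r :: "real \<Rightarrow> real \<Rightarrow> real \<Rightarrow> real" where
  "d2r a p1 p2 = (a - p2 + p1) * (1 - a)"

definition k2 :: "real \<Rightarrow> real \<Rightarrow> real \<Rightarrow> real" where
  "k2 a p1 p2 = (a\<^sup>2 - p2\<^sup>2) / 2 + (p1 - p2) * (a - p2)"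

definition profit1 :: "real \<Rightarrow> real \<Rightarrow> real \<Rightarrow> real \<Rightarrow> real" where
  "profit1 a r p1 p2 = (p1 + r) * (d1n a p1 p2 + k1 a p1 p2) - r"

definition profit2 :: "real \<Rightarrow> real \<Rightarrow> real \<Rightarrow> real \<Rightarrow> real" where
  "profit2 a r p1 p2 = (p2 + r) * (d2r a p1 p2 + k2 a p1 p2) - r * (1 - d1n a p1 p2)"

definition equilibrium :: "real \<Rightarrow> real \<Rightarrow> real \<Rightarrow> real \<Rightarrow> bool" where
  "equilibrium a r p1 p2 \<longleftrightarrow>
     p1 \<in> {0..} \<and> (\<forall>q\<in>{0..}. profit1 a r q p2 \<le> profit1 a r p1 p2) \<and>
     p2 \<in> {0..a} \<and> (\<forall>q\<in>{0..a}. profit2 a r p1 q \<le> profit2 a r p1 p2)"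

text \<open>The return cost \<open>(1 - a)\<^sup>2\<close> at which the price ranking is reversed.\<close>

definition return_cost_threshold :: "real \<Rightarrow> real" where
  "return_cost_threshold a = (1 - a)\<^sup>2"

section \<open>Consumers\<close>

definition match_dist :: "real measure" where
  "match_dist = uniform_measure lborel {0..1}"

text \<open>
  Realized payoff of a consumer who inspects first a product with price \<open>pf\<close> and match value \<open>u\<close>,
  and pays \<open>s\<close> to inspect as well the other one, with price \<open>ps\<close> and match value \<open>v\<close>, iff
  \<open>u \<in> C\<close>. At the end she keeps the best inspected product or nothing (refunds are full).

  The first inspection is free, whichever product it is, as for the prominent product in the model.
  Charging any nonnegative common cost for it would not affect the comparison of the two orders.
\<close>

definition realized_payoff :: "real \<Rightarrow> real \<Rightarrow> real \<Rightarrow> real set \<Rightarrow> real \<times> real \<Rightarrow> real" where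
  "realized_payoff s pf ps C = (\<lambda>(u, v).
     if u \<in> C then max 0 (max (u - pf) (v - ps)) - s else max 0 (u - pf))"

text \<open>
  The match values are i.i.d., so the consumer has the same prior about the product inspected first
  whichever of the two products it is.
\<close>

definition expected_payoff :: "real \<Rightarrow> real \<Rightarrow> real \<Rightarrow> real set \<Rightarrow> real" where
  "expected_payoff s pf ps C =
     (\<integral>w. realized_payoff s pf ps C w \<partial>(match_dist \<Otimes>\<^sub>M match_dist))"

datatype firm = Firm1 | Firm2

text \<open>
  A search policy consists of the firm visited first and the set of match values found there that
  make the consumer go on to the other firm.
\<close>

fun policy_payoff :: "real \<Rightarrow> real \<Rightarrow> real \<Rightarrow> firm \<times> real set \<Rightarrow> real" where
  "policy_payoff s p1 p2 (Firm1, C) = expected_payoff s p1 p2 C"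
| "policy_payoff s p1 p2 (Firm2, C) = expected_payoff s p2 p1 C"

definition policies :: "(firm \<times> real set) set" where
  "policies = UNIV \<times> sets borel"

definition rational_policy :: "real \<Rightarrow> real \<Rightarrow> real \<Rightarrow> firm \<times> real set \<Rightarrow> bool" where
  "rational_policy s p1 p2 P \<longleftrightarrow>
     P \<in> policies \<and> (\<forall>Q\<in>policies. policy_payoff s p1 p2 Q \<le> policy_payoff s p1 p2 P)"

text \<open>
  The behaviour underlying the demand functions: Firm 1 first, then Firm 2 iff \<open>u1 < a + p1 - p2\<close>.
\<close>

definition prominent_first_policy :: "real \<Rightarrow> real \<Rightarrow> real \<Rightarrow> firm \<times> real set" where
  "prominent_first_policy a p1 p2 = (Firm1, {u. u < a + p1 - p2})"

end

(*
  Adding the two first-order conditions gives (p1 - p2) (3 - 2 p2 - r) = (1 - a)^2 - r, which settles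
  the price ranking. For the search order, let u and v be the match values of the first and the
  second product inspected, with prices pf and ps. Since E (v - a)^+ = s, no policy yields more than
  E max (0, u - pf, min (v, a) - ps), and the cutoff policy attains this bound. With u the match
  value of Firm 1 under either order and p1 <= p2 < a, the bound for Firm 1 first exceeds the one
  for Firm 2 first pointwise by at least (u - a)^+ - (v - a)^+, which has mean zero; the inequality
  is strict for u, v > a if p1 < p2.
*)

theory Submission
  imports Defs
begin

section \<open>Equilibrium prices\<close>

text \<open>In its own price, \<open>profit1\<close> is a quadratic with leading coefficient -1 and
  vertex \<open>m\<close>. Since r \<le> 1 - a and p2 \<le> a, the vertex is nonnegative, hence
  feasible, and optimality forces \<open>p1 = m\<close>.\<close>

lemma equilibrium_price1:
  assumes eq: "equilibrium a r p1 p2" and "r \<le> 1 - a"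
  shows "2 * p1 = 1 - a + p2 + (a\<^sup>2 - p2\<^sup>2) / 2 - r"
proof -
  define m where "m = (1 - a + p2 + (a\<^sup>2 - p2\<^sup>2) / 2 - r) / 2"
  have p2: "0 \<le> p2" "p2 \<le> a"
    using eq by (auto simp: equilibrium_def)
  then have "0 \<le> (a\<^sup>2 - p2\<^sup>2) / 2"
    by (simp add: power_mono)
  moreover have "2 * m = (1 - a - r) + p2 + (a\<^sup>2 - p2\<^sup>2) / 2"
    by (simp add: m_def)
  ultimately have "0 \<le> m"
    using assms(2) p2 by linarith
  then have "profit1 a r m p2 \<le> profit1 a r p1 p2"
    using eq by (auto simp: equilibrium_def)
  moreover have "profit1 a r m p2 - profit1 a r p1 p2 = (m - p1)\<^sup>2"
    unfolding profit1_def d1n_def k1_def m_def by (simp add: power2_eq_square field_simps)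
  ultimately have "(m - p1)\<^sup>2 \<le> 0"
    by linarith
  then have "m = p1"
    by simp
  then show ?thesis
    by (simp add: m_def)
qed

definition marginal_profit2 :: "real \<Rightarrow> real \<Rightarrow> real \<Rightarrow> real \<Rightarrow> real" where
  "marginal_profit2 a r p1 p2 =
     a - a\<^sup>2 / 2 + p1 - 2 * p2 * (1 + p1) + 3 * p2\<^sup>2 / 2 + r * p2 - r * p1"

lemma DERIV_profit2: "DERIV (profit2 a r p1) p2 :> marginal_profit2 a r p1 p2"
  unfolding profit2_def[abs_def] d2r_def k2_def d1n_def marginal_profit2_def
  by (auto intro!: derivative_eq_intros simp: power2_eq_square field_simps)

text \<open>\<open>profit2\<close> is cubic in p2, so the optimum is located by the sign of its
  derivative: positive at 0 and negative at a corner \<open>p2 = a\<close>. Both corners are thereby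
  excluded, and an interior optimum has derivative zero.\<close>

lemma equilibrium_price2:
  assumes eq: "equilibrium a r p1 p2" and a: "1/2 < a" "a < 1" and r: "0 \<le> r" "r \<le> 1 - a"
  shows "marginal_profit2 a r p1 p2 = 0" and "p2 < a"
proof -
  have p1: "0 \<le> p1" and p2: "0 \<le> p2" "p2 \<le> a"
    and opt: "\<And>q. 0 \<le> q \<Longrightarrow> q \<le> a \<Longrightarrow> profit2 a r p1 q \<le> profit2 a r p1 p2"
    using eq by (auto simp: equilibrium_def)
  have p1_pos: "0 < p1" if "p2 = a"
    using equilibrium_price1[OF eq] a r that by simp
  have at_0: "0 < marginal_profit2 a r p1 0"
  proof -
    have "0 < a * (1 - a / 2)" "0 \<le> p1 * (1 - r)"
      using a r p1 by (auto intro!: mult_nonneg_nonneg)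
    then show ?thesis
      by (simp add: marginal_profit2_def power2_eq_square algebra_simps)
  qed
  \<comment> \<open>At p2 = a the derivative is -a (1 - a - r) - p1 (2 a + r - 1). Strictness comes
    from a > 1/2 and from p1 = (1 - r) / 2 > 0, the best response to a.\<close>
  have at_a: "marginal_profit2 a r p1 a < 0" if "p2 = a"
  proof -
    have "0 \<le> a * (1 - a - r)" "0 < p1 * (2 * a + r - 1)"
      using a r p1_pos[OF that] by (auto intro!: mult_nonneg_nonneg)
    then show ?thesis
      by (simp add: marginal_profit2_def power2_eq_square algebra_simps)
  qed
  have le: "marginal_profit2 a r p1 p2 \<le> 0" if "p2 < a"
  proof (rule ccontr)
    assume "\<not> ?thesis"
    then obtain d where d: "d > 0" "\<And>h. 0 < h \<Longrightarrow> h < d \<Longrightarrow> profit2 a r p1 p2 < profit2 a r p1 (p2 + h)"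
      using DERIV_pos_inc_right[OF DERIV_profit2] by (metis not_le)
    define h where "h = min (d / 2) (a - p2)"
    have "0 < h" "h < d" "p2 + h \<le> a"
      using d(1) that by (auto simp: h_def)
    with d(2)[of h] opt[of "p2 + h"] p2 show False
      by simp
  qed
  have ge: "0 \<le> marginal_profit2 a r p1 p2" if "0 < p2"
  proof (rule ccontr)
    assume "\<not> ?thesis"
    then obtain d where d: "d > 0" "\<And>h. 0 < h \<Longrightarrow> h < d \<Longrightarrow> profit2 a r p1 p2 < profit2 a r p1 (p2 - h)"
      using DERIV_neg_dec_left[OF DERIV_profit2] by (metis not_le)
    define h where "h = min (d / 2) p2"
    have "0 < h" "h < d" "0 \<le> p2 - h"
      using d(1) that by (auto simp: h_def)
    with d(2)[of h] opt[of "p2 - h"] p2 show False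
      by simp
  qed
  show "p2 < a"
    using at_a ge p2 a by (cases "p2 = a") auto
  with le have "p2 \<noteq> 0"
    using at_0 a by auto
  with le ge p2 \<open>p2 < a\<close> show "marginal_profit2 a r p1 p2 = 0"
    by simp
qed

lemma equilibrium_price_difference:
  assumes "equilibrium a r p1 p2" "1/2 < a" "a < 1" "0 \<le> r" "r \<le> 1 - a"
  shows "(p1 - p2) * (3 - 2 * p2 - r) = return_cost_threshold a - r"
proof -
  have p1: "2 * p1 = 1 - a + p2 + (a\<^sup>2 - p2\<^sup>2) / 2 - r"
    using assms by (intro equilibrium_price1) auto
  \<comment> \<open>The right-hand side is the marginal profit of Firm 2 minus that of Firm 1; both
    vanish in equilibrium.\<close>
  have "(p1 - p2) * (3 - 2 * p2 - r) - (return_cost_threshold a - r)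
      = marginal_profit2 a r p1 p2 + (2 * p1 - (1 - a + p2 + (a\<^sup>2 - p2\<^sup>2) / 2 - r))"
    unfolding marginal_profit2_def return_cost_threshold_def
    by (simp add: power2_eq_square field_simps)
  also have "\<dots> = 0"
    unfolding p1 equilibrium_price2(1)[OF assms] by simp
  finally show ?thesis
    by simp
qed

lemma sgn_equilibrium_price_difference:
  assumes "equilibrium a r p1 p2" "1/2 < a" "a < 1" "0 \<le> r" "r \<le> 1 - a"
  shows "sgn (p1 - p2) = sgn (return_cost_threshold a - r)"
proof -
  have "p2 < a"
    using equilibrium_price2(2)[OF assms] .
  \<comment> \<open>Indeed 3 - 2 p2 - r > 3 - 2 a - (1 - a) = 2 - a > 0.\<close>
  then have "0 < 3 - 2 * p2 - r"
    using assms by simp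
  then show ?thesis
    unfolding equilibrium_price_difference[OF assms, symmetric] by (simp add: sgn_mult)
qed

section \<open>Consumer search\<close>

lemma sets_match_dist [measurable_cong]: "sets match_dist = sets borel"
  by (simp add: match_dist_def)

lemma space_match_dist [simp]: "space match_dist = UNIV"
  by (simp add: match_dist_def)

lemma prob_space_match_dist: "prob_space match_dist"
  unfolding match_dist_def by (rule prob_space_uniform_measure) auto

interpretation match: prob_space match_dist
  by (rule prob_space_match_dist)

interpretation match_pair: pair_prob_space match_dist match_dist ..

lemma AE_match_dist: "AE u in match_dist. u \<in> {0..1}"
  unfolding match_dist_def by (rule AE_uniform_measureI) auto

lemma AE_match_pair: "AE w in match_dist \<Otimes>\<^sub>M match_dist. fst w \<in> {0..1} \<and> snd w \<in> {0..1}"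
proof (rule match_pair.AE_pair_measure)
  show "AE u in match_dist. AE v in match_dist. fst (u, v) \<in> {0..1} \<and> snd (u, v) \<in> {0..1}"
    using AE_match_dist
  proof eventually_elim
    case (elim u)
    show ?case
      using AE_match_dist by eventually_elim (use elim in simp)
  qed
qed measurable

text \<open>Match values lie in [0, 1] almost surely, so linear growth amounts to the constant bound
  \<open>2 + B\<close>.\<close>

lemma integrable_match_pair:
  fixes f :: "real \<times> real \<Rightarrow> real"
  assumes [measurable]: "f \<in> borel_measurable (match_dist \<Otimes>\<^sub>M match_dist)"
    and bound: "\<And>u v. \<bar>f (u, v)\<bar> \<le> \<bar>u\<bar> + \<bar>v\<bar> + B"
  shows "integrable (match_dist \<Otimes>\<^sub>M match_dist) f"
proof (rule match_pair.P.integrable_const_bound[where B = "2 + B"])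
  show "AE w in match_dist \<Otimes>\<^sub>M match_dist. norm (f w) \<le> 2 + B"
    using AE_match_pair
  proof eventually_elim
    case (elim w)
    then show ?case
      using bound[of "fst w" "snd w"] by simp
  qed
qed measurable

text \<open>This identifies a = 1 - sqrt (2 s) as the reservation value: the expected gain from a
  second inspection over a sure a equals its cost s.\<close>

lemma integral_match_dist_excess:
  assumes "0 \<le> a" "a \<le> 1"
  shows "(\<integral>v. max 0 (v - a) \<partial>match_dist) = (1 - a)\<^sup>2 / 2"
proof -
  have "match_dist = density lborel (\<lambda>x. ennreal (indicator {0..1} x))"
    by (simp add: match_dist_def uniform_measure_def ennreal_indicator divide_ennreal_def)
  then have "(\<integral>v. max 0 (v - a) \<partial>match_dist)
      = (\<integral>v. max 0 (v - a) \<partial>density lborel (\<lambda>x. ennreal (indicator {0..1} x)))"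
    by (simp only:)
  also have "\<dots> = (\<integral>v. indicator {0..1} v * max 0 (v - a) \<partial>lborel)"
    by (rule integral_real_density) auto
  also have "\<dots> = (\<integral>v. (v - a) * indicator {a..1} v \<partial>lborel)"
    using assms by (intro Bochner_Integration.integral_cong) (auto simp: indicator_def)
  also have "\<dots> = (1 - a)\<^sup>2 / 2 - (a - a)\<^sup>2 / 2"
    using assms by (intro integral_FTC_Icc_real) (auto intro!: derivative_eq_intros)
  finally show ?thesis
    by simp
qed

lemma measure_match_dist_greaterThan:
  assumes "0 \<le> a" "a \<le> 1"
  shows "measure match_dist {a<..} = 1 - a"
proof -
  have "{0..1} \<inter> {a<..} = {a<..1}"
    using assms by auto
  then show ?thesis
    using assms unfolding match_dist_def by (subst measure_uniform_measure) auto
qed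

section \<open>Upper bound on the payoff of a search policy\<close>

text \<open>
  The payoff if the second inspection were free but the match value found there were capped at \<open>a\<close>.
  It has the same mean as the payoff of the cutoff policy.
\<close>

definition capped_payoff :: "real \<Rightarrow> real \<Rightarrow> real \<Rightarrow> real \<times> real \<Rightarrow> real" where
  "capped_payoff a pf ps = (\<lambda>(u, v). max 0 (max (u - pf) (min v a - ps)))"

text \<open>If the search goes on, v = min v a + (v - a)^+ and the last term can be pulled out of
  the maximum. If it stops, the capped payoff only adds an option.\<close>

lemma realized_payoff_le_capped:
  "realized_payoff s pf ps C (u, v)
     \<le> capped_payoff a pf ps (u, v) + indicator C u * (max 0 (v - a) - s)"
  by (cases "u \<in> C") (auto simp: realized_payoff_def capped_payoff_def)

text \<open>The bound is tight on both sides of the cutoff. Going on means u - pf < a - ps, so any v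
  > a is the best choice; stopping means u - pf \<ge> a - ps, so the capped second product never
  beats the first. Here \<open>ps < a\<close> makes the outside option 0 worse than a - ps.\<close>

lemma realized_payoff_cutoff:
  assumes "ps < a"
  shows "realized_payoff s pf ps {u. u < a + pf - ps} (u, v)
     = capped_payoff a pf ps (u, v) + indicator {u. u < a + pf - ps} u * (max 0 (v - a) - s)"
  using assms
  by (cases "u < a + pf - ps"; cases "v \<le> a") (auto simp: realized_payoff_def capped_payoff_def)

lemma integrable_realized_payoff:
  assumes [measurable]: "C \<in> sets borel"
  shows "integrable (match_dist \<Otimes>\<^sub>M match_dist) (realized_payoff s pf ps C)"
proof (rule integrable_match_pair)
  show "realized_payoff s pf ps C \<in> borel_measurable (match_dist \<Otimes>\<^sub>M match_dist)"
    unfolding realized_payoff_def case_prod_beta by measurable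
  show "\<bar>realized_payoff s pf ps C (u, v)\<bar> \<le> \<bar>u\<bar> + \<bar>v\<bar> + (\<bar>pf\<bar> + \<bar>ps\<bar> + \<bar>s\<bar>)" for u v
    by (auto simp: realized_payoff_def)
qed

lemma integrable_capped_payoff:
  "integrable (match_dist \<Otimes>\<^sub>M match_dist) (capped_payoff a pf ps)"
proof (rule integrable_match_pair)
  show "capped_payoff a pf ps \<in> borel_measurable (match_dist \<Otimes>\<^sub>M match_dist)"
    unfolding capped_payoff_def case_prod_beta by measurable
  show "\<bar>capped_payoff a pf ps (u, v)\<bar> \<le> \<bar>u\<bar> + \<bar>v\<bar> + (\<bar>pf\<bar> + \<bar>ps\<bar> + \<bar>a\<bar>)" for u v
    by (auto simp: capped_payoff_def)
qed

lemma
  assumes [measurable]: "C \<in> sets borel" and "0 \<le> a" "a \<le> 1" and s: "s = (1 - a)\<^sup>2 / 2"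
  shows integrable_inspection_excess:
      "integrable (match_dist \<Otimes>\<^sub>M match_dist) (\<lambda>(u, v). indicator C u * (max 0 (v - a) - s))"
    and integral_inspection_excess:
      "(\<integral>(u, v). indicator C u * (max 0 (v - a) - s) \<partial>(match_dist \<Otimes>\<^sub>M match_dist)) = 0"
proof -
  show int: "integrable (match_dist \<Otimes>\<^sub>M match_dist) (\<lambda>(u, v). indicator C u * (max 0 (v - a) - s))"
  proof (rule integrable_match_pair)
    show "\<bar>case (u, v) of (u, v) \<Rightarrow> indicator C u * (max 0 (v - a) - s)\<bar> \<le> \<bar>u\<bar> + \<bar>v\<bar> + (\<bar>a\<bar> + \<bar>s\<bar>)"
      for u v
      by (auto simp: indicator_def)
  qed measurable
  have "integrable match_dist (\<lambda>v. max 0 (v - a))"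
  proof (rule match.integrable_const_bound[where B = "1 + \<bar>a\<bar>"])
    show "AE v in match_dist. norm (max 0 (v - a)) \<le> 1 + \<bar>a\<bar>"
      using AE_match_dist by eventually_elim auto
  qed measurable
  \<comment> \<open>The decision to go on depends on u alone, so v can be integrated first, and the
    inner mean is zero by the choice of a.\<close>
  then have "(\<integral>v. max 0 (v - a) - s \<partial>match_dist) = 0"
    using integral_match_dist_excess[of a] assms by (simp add: match.prob_space[simplified])
  then show "(\<integral>(u, v). indicator C u * (max 0 (v - a) - s) \<partial>(match_dist \<Otimes>\<^sub>M match_dist)) = 0"
    by (subst match_pair.integral_fst[OF int, symmetric]) simp
qed

lemma expected_payoff_le:
  assumes C: "C \<in> sets borel" and a: "0 \<le> a" "a \<le> 1" and s: "s = (1 - a)\<^sup>2 / 2"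
  shows "expected_payoff s pf ps C \<le> (\<integral>w. capped_payoff a pf ps w \<partial>(match_dist \<Otimes>\<^sub>M match_dist))"
proof -
  note int = integrable_inspection_excess[OF C a s] integrable_capped_payoff[of a pf ps]
  have "expected_payoff s pf ps C
      \<le> (\<integral>w. capped_payoff a pf ps w + (case w of (u, v) \<Rightarrow> indicator C u * (max 0 (v - a) - s))
           \<partial>(match_dist \<Otimes>\<^sub>M match_dist))"
    unfolding expected_payoff_def
    using int integrable_realized_payoff[OF C] realized_payoff_le_capped
    by (intro integral_mono) auto
  then show ?thesis
    using int integral_inspection_excess[OF C a s] by simp
qed

lemma expected_payoff_cutoff:
  assumes a: "0 \<le> a" "a \<le> 1" and s: "s = (1 - a)\<^sup>2 / 2" and "ps < a"
  shows "expected_payoff s pf ps {u. u < a + pf - ps}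
     = (\<integral>w. capped_payoff a pf ps w \<partial>(match_dist \<Otimes>\<^sub>M match_dist))"
proof -
  define C where "C = {u. u < a + pf - ps}"
  have C: "C \<in> sets borel"
    by (simp add: C_def)
  note int = integrable_inspection_excess[OF C a s] integrable_capped_payoff[of a pf ps]
  have "expected_payoff s pf ps C
      = (\<integral>w. capped_payoff a pf ps w + (case w of (u, v) \<Rightarrow> indicator C u * (max 0 (v - a) - s))
           \<partial>(match_dist \<Otimes>\<^sub>M match_dist))"
    unfolding expected_payoff_def C_def
    using realized_payoff_cutoff[OF \<open>ps < a\<close>]
    by (intro Bochner_Integration.integral_cong) auto
  then show ?thesis
    using int integral_inspection_excess[OF C a s] by (simp add: C_def)
qed

section \<open>Comparison of the two search orders\<close>

text \<open>
  The arguments \<open>(u, v)\<close> are the match values of Firm 1 and Firm 2, hence the swap in the second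
  payoff. The subtracted term has mean zero and makes the difference nonnegative pointwise.
\<close>

definition order_gain :: "real \<Rightarrow> real \<Rightarrow> real \<Rightarrow> real \<times> real \<Rightarrow> real" where
  "order_gain a p1 p2 = (\<lambda>(u, v). capped_payoff a p1 p2 (u, v) - capped_payoff a p2 p1 (v, u)
     - (max 0 (u - a) - max 0 (v - a)))"

text \<open>The gain is zero for v \<le> a. For u \<le> a < v it is max (u - p1 + v - a) (v - p2) -
  max (u - p1) (v - p2), and for u, v > a it is min (p2 - p1) (v - a).\<close>

lemma order_gain_nonneg:
  assumes "p1 \<le> p2" "p2 < a"
  shows "0 \<le> order_gain a p1 p2 (u, v)"
  using assms by (cases "u \<le> a"; cases "v \<le> a") (auto simp: order_gain_def capped_payoff_def)

lemma order_gain_pos: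
  assumes "p1 < p2" "p2 < a" "a < u" "a < v"
  shows "0 < order_gain a p1 p2 (u, v)"
  using assms by (simp add: order_gain_def capped_payoff_def)

lemma
  shows integrable_order_gain: "integrable (match_dist \<Otimes>\<^sub>M match_dist) (order_gain a p1 p2)"
    and integral_order_gain: "(\<integral>w. order_gain a p1 p2 w \<partial>(match_dist \<Otimes>\<^sub>M match_dist))
      = (\<integral>w. capped_payoff a p1 p2 w \<partial>(match_dist \<Otimes>\<^sub>M match_dist))
        - (\<integral>w. capped_payoff a p2 p1 w \<partial>(match_dist \<Otimes>\<^sub>M match_dist))"
proof -
  define M where "M = match_dist \<Otimes>\<^sub>M match_dist"
  define swapped :: "real \<times> real \<Rightarrow> real" where "swapped = (\<lambda>(u, v). capped_payoff a p2 p1 (v, u))"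
  define excess1 :: "real \<times> real \<Rightarrow> real" where "excess1 = (\<lambda>(u, v). max 0 (u - a))"
  define excess2 :: "real \<times> real \<Rightarrow> real" where "excess2 = (\<lambda>(u, v). max 0 (v - a))"
  have excess1 [simp]: "integrable M excess1"
    unfolding M_def
  proof (rule integrable_match_pair)
    show "excess1 \<in> borel_measurable (match_dist \<Otimes>\<^sub>M match_dist)"
      unfolding excess1_def by measurable
    show "\<bar>excess1 (u, v)\<bar> \<le> \<bar>u\<bar> + \<bar>v\<bar> + \<bar>a\<bar>" for u v
      by (auto simp: excess1_def)
  qed
  have capped [simp]: "integrable M (capped_payoff a p p')" for p p'
    unfolding M_def by (rule integrable_capped_payoff)
  \<comment> \<open>Exchanging the two i.i.d. coordinates preserves integrals. This undoes the swap
    in the Firm-2-first payoff and gives both excess terms the same mean.\<close>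
  have int_swap: "integrable M (\<lambda>(u, v). f (v, u))" "(\<integral>(u, v). f (v, u) \<partial>M) = (\<integral>w. f w \<partial>M)"
    if "integrable M f" for f :: "real \<times> real \<Rightarrow> real"
    using match_pair.integrable_product_swap match_pair.integral_product_swap that
    unfolding M_def by (blast dest: borel_measurable_integrable)+
  have excess2: "integrable M excess2" "(\<integral>w. excess2 w \<partial>M) = (\<integral>w. excess1 w \<partial>M)"
    using int_swap[OF excess1] by (simp_all only: excess1_def excess2_def prod.case)
  have swapped: "integrable M swapped" "(\<integral>w. swapped w \<partial>M) = (\<integral>w. capped_payoff a p2 p1 w \<partial>M)"
    using int_swap[OF capped] by (simp_all only: swapped_def)
  have eq: "order_gain a p1 p2 = (\<lambda>w. capped_payoff a p1 p2 w - swapped w - (excess1 w - excess2 w))"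
    by (auto simp: order_gain_def swapped_def excess1_def excess2_def fun_eq_iff)
  note int = capped[of p1 p2] swapped excess1 excess2
  show "integrable (match_dist \<Otimes>\<^sub>M match_dist) (order_gain a p1 p2)"
    unfolding eq M_def[symmetric] using int by (intro Bochner_Integration.integrable_diff)
  show "(\<integral>w. order_gain a p1 p2 w \<partial>(match_dist \<Otimes>\<^sub>M match_dist))
      = (\<integral>w. capped_payoff a p1 p2 w \<partial>(match_dist \<Otimes>\<^sub>M match_dist))
        - (\<integral>w. capped_payoff a p2 p1 w \<partial>(match_dist \<Otimes>\<^sub>M match_dist))"
    unfolding eq M_def[symmetric] using int
    by (simp only: Bochner_Integration.integral_diff Bochner_Integration.integrable_diff)
qed

lemma integral_capped_payoff_mono:
  assumes "p1 \<le> p2" "p2 < a"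
  shows "(\<integral>w. capped_payoff a p2 p1 w \<partial>(match_dist \<Otimes>\<^sub>M match_dist))
     \<le> (\<integral>w. capped_payoff a p1 p2 w \<partial>(match_dist \<Otimes>\<^sub>M match_dist))"
proof -
  have "0 \<le> (\<integral>w. order_gain a p1 p2 w \<partial>(match_dist \<Otimes>\<^sub>M match_dist))"
    using order_gain_nonneg[OF assms] by (intro integral_nonneg_AE) auto
  then show ?thesis
    using integral_order_gain[of a p1 p2] by linarith
qed

lemma integral_capped_payoff_strict_mono:
  assumes a: "0 \<le> a" "a < 1" and p: "p1 < p2" "p2 < a"
  shows "(\<integral>w. capped_payoff a p2 p1 w \<partial>(match_dist \<Otimes>\<^sub>M match_dist))
     < (\<integral>w. capped_payoff a p1 p2 w \<partial>(match_dist \<Otimes>\<^sub>M match_dist))"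
proof (rule ccontr)
  assume "\<not> ?thesis"
  moreover have "(\<integral>w. capped_payoff a p2 p1 w \<partial>(match_dist \<Otimes>\<^sub>M match_dist))
     \<le> (\<integral>w. capped_payoff a p1 p2 w \<partial>(match_dist \<Otimes>\<^sub>M match_dist))"
    using p by (intro integral_capped_payoff_mono) auto
  ultimately have "(\<integral>w. order_gain a p1 p2 w \<partial>(match_dist \<Otimes>\<^sub>M match_dist)) = 0"
    using integral_order_gain[of a p1 p2] by linarith
  moreover have "0 \<le> order_gain a p1 p2 w" for w
    using order_gain_nonneg[of p1 p2 a "fst w" "snd w"] p by simp
  ultimately have "AE w in match_dist \<Otimes>\<^sub>M match_dist. order_gain a p1 p2 w = 0"
    using integral_nonneg_eq_0_iff_AE[OF integrable_order_gain[of a p1 p2]] by simp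
  \<comment> \<open>The gain is positive on this square, whose probability (1 - a)^2 is positive, so
    it cannot vanish almost everywhere.\<close>
  then have "AE w in match_dist \<Otimes>\<^sub>M match_dist. w \<notin> {a<..} \<times> {a<..}"
  proof eventually_elim
    case (elim w)
    then show ?case
      using order_gain_pos[OF p, of "fst w" "snd w"] by (cases w) auto
  qed
  then have "measure (match_dist \<Otimes>\<^sub>M match_dist) ({a<..} \<times> {a<..}) = 0"
    by (subst match_pair.P.prob_eq_0) auto
  moreover have "measure (match_dist \<Otimes>\<^sub>M match_dist) ({a<..} \<times> {a<..}) = (1 - a) * (1 - a)"
    using a measure_match_dist_greaterThan[of a]
    by (simp add: measure_def match.emeasure_pair_measure_Times enn2real_mult sets_match_dist)
  ultimately show False
    using a by simp
qed

section \<open>Rational search policies\<close>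

lemma rational_prominent_first_policy:
  assumes a: "0 \<le> a" "a < 1" and s: "s = (1 - a)\<^sup>2 / 2" and p: "p1 \<le> p2" "p2 < a"
  shows "rational_policy s p1 p2 (prominent_first_policy a p1 p2)"
proof -
  have "policy_payoff s p1 p2 Q \<le> policy_payoff s p1 p2 (prominent_first_policy a p1 p2)"
    if Q: "Q \<in> policies" for Q
  proof -
    obtain f C where [simp]: "Q = (f, C)"
      by (cases Q)
    have C: "C \<in> sets borel"
      using Q by (auto simp: policies_def)
    show ?thesis
      using expected_payoff_le[OF C _ _ s] expected_payoff_cutoff[OF _ _ s p(2)] a
        integral_capped_payoff_mono[OF p]
      by (cases f) (auto simp: prominent_first_policy_def intro: order_trans)
  qed
  then show ?thesis
    by (auto simp: rational_policy_def policies_def prominent_first_policy_def)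
qed

lemma rational_policy_prominent_first:
  assumes a: "0 \<le> a" "a < 1" and s: "s = (1 - a)\<^sup>2 / 2" and p: "p1 < p2" "p2 < a"
    and rational: "rational_policy s p1 p2 P"
  shows "fst P = Firm1"
proof (rule ccontr)
  assume "fst P \<noteq> Firm1"
  then obtain C where P: "P = (Firm2, C)"
    by (metis firm.exhaust prod.collapse)
  have C: "C \<in> sets borel"
    using rational by (auto simp: rational_policy_def policies_def P)
  have "prominent_first_policy a p1 p2 \<in> policies"
    by (simp add: prominent_first_policy_def policies_def)
  then have "policy_payoff s p1 p2 (prominent_first_policy a p1 p2) \<le> policy_payoff s p1 p2 P"
    using rational by (simp add: rational_policy_def)
  then show False
    using expected_payoff_le[OF C _ _ s, of p2 p1] expected_payoff_cutoff[OF _ _ s p(2), of p1] a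
      integral_capped_payoff_strict_mono[OF a p]
    by (simp add: prominent_first_policy_def P)
qed

text \<open>At the threshold the price difference is exactly zero, so the strict ranking starts just
  above it. With equal prices the two orders are symmetric; Firm 1 first is then optimal but not the
  only optimal order.\<close>

theorem mainTheorem14:
  fixes s a r p1 p2 :: real
  assumes "0 < s" and "s < 1/8"
    and "a = 1 - sqrt (2 * s)"
    and "equilibrium a r p1 p2"
  shows "(0 \<le> r \<and> r < return_cost_threshold a \<longrightarrow> p1 > p2) \<and>
    (return_cost_threshold a < r \<and> r \<le> 1 - a \<longrightarrow>
       p1 < p2 \<and>
       rational_policy s p1 p2 (prominent_first_policy a p1 p2) \<and>
       (\<forall>P. rational_policy s p1 p2 P \<longrightarrow> fst P = Firm1)) \<and>
    (r = return_cost_threshold a \<longrightarrow>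
       p1 = p2 \<and>
       rational_policy s p1 p2 (prominent_first_policy a p1 p2))"
proof -
  have "sqrt (2 * s) < sqrt ((1/2)\<^sup>2)"
    using assms(2) by (intro real_sqrt_less_mono) (simp add: power2_eq_square)
  then have a: "1/2 < a" "a < 1"
    using assms by auto
  have s: "s = (1 - a)\<^sup>2 / 2"
    using assms by simp
  \<comment> \<open>The threshold lies in [0, 1 - a], so each of the three ranges of r meets the
    conditions 0 \<le> r \<le> 1 - a of the sign lemma.\<close>
  have threshold: "0 \<le> return_cost_threshold a" "return_cost_threshold a \<le> 1 - a"
    using a mult_left_le_one_le[of "1 - a" "1 - a"]
    by (auto simp: return_cost_threshold_def power2_eq_square)
  have sgn: "sgn (p1 - p2) = sgn (return_cost_threshold a - r)" if "0 \<le> r" "r \<le> 1 - a"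
    using sgn_equilibrium_price_difference[OF assms(4) a that] .
  have p2: "p2 < a" if "0 \<le> r" "r \<le> 1 - a"
    using equilibrium_price2(2)[OF assms(4) a that] .
  have low: "p1 > p2" if "0 \<le> r" "r < return_cost_threshold a"
    using sgn that threshold by (simp add: sgn_if split: if_splits)
  have high: "p1 < p2" if "return_cost_threshold a < r" "r \<le> 1 - a"
    using sgn that threshold by (simp add: sgn_if split: if_splits)
  have equal: "p1 = p2" if "r = return_cost_threshold a"
    using sgn that threshold by (simp add: sgn_zero_iff)
  show ?thesis
    using low high equal p2 threshold a s rational_prominent_first_policy[of a s p1 p2]
      rational_policy_prominent_first[of a s p1 p2]
    by auto
qed

end
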